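(* Assume that there exist a constant $c_0>0$ and a function $\alpha:[1,T]\to[2,+\infty)$ with $\alpha^+:=\max_{k\in[1,T]}\alpha(k)<p^-$ such that $F(k,t)\le c_0(1+|t|^{\alpha(k)})$ for all $(k,t)\in[1,T]\times\mathbb{R}$. Assume further that there exist a non-negative constant $c_1$ and two positive constants $c_2$ and $d$ such that $$\frac{K}{A^{1/p^+}}\,c_1<d<\left(\frac{p^-K^{p^+}}{p^+A}\right)^{\frac{1}{p^-}}c_2^{\frac{p^+}{p^-}}<\left(\frac{p^-}{p^+A}\right)^{\frac{1}{p^-}}$$ and $$a_d(c_2)<a_d(c_1).$$ Then for every $\lambda\in\left]\frac{1}{a_d(c_1)},\frac{1}{a_d(c_2)}\right[$ the problem $$\begin{cases}-\Delta\big(w(k-1)|\Delta u(k-1)|^{p(k-1)-2}\Delta u(k-1)\big)+q(k)|u(k)|^{p(k)-2}u(k)=\lambda f(k,u(k)), & k\in[1,T],\\ u(0)=u(T+1)=0,\end{cases}$$ has at least one non-trivial solution $u_0\in W$.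
   Context: $T\ge 2$ is a fixed integer; intervals such as $[1,T]$, $[0,T+1]$ serving as domains are discrete: $[a,b]=\{a,a+1,\dots,b\}$. $f:[1,T]\times\mathbb{R}\to\mathbb{R}$ is continuous and $F(k,t):=\int_0^t f(k,\xi)\,d\xi$. $w:[0,T]\to[1,\infty)$, $p:[0,T+1]\to[2,\infty)$, $q:[0,T+1]\to[1,\infty)$ are given functions, with $w^+:=\max_{k\in[0,T]}w(k)$, $p^-:=\min_{k\in[0,T+1]}p(k)$, $p^+:=\max_{k\in[0,T+1]}p(k)$, $q^+:=\max_{k\in[1,T+1]}q(k)$. $\Delta u(k)=u(k+1)-u(k)$ is the forward difference operator (the outer $\Delta$ acts in the variable $k-1$, i.e. $\Delta(h(k-1))=h(k)-h(k-1)$). $W:=\{u:[0,T+1]\to\mathbb{R}: u(0)=u(T+1)=0\}$. Put $$A=w(0)+w(T)+\sum_{k=1}^{T}q(k),\qquad K=(2T+2)^{\frac{1-p^+}{p^+}}\big(\max\{w^+,q^+\}\big)^{\frac{p^--p^+}{p^+p^-}},$$ and for non-negative constants $c,d$ with $\frac{1}{p^+}(cK)^{p^+}\ne\frac{d^{p^-}}{p^-}A$ put $$a_d(c):=\frac{\sum_{k=1}^{T}\max_{|\xi|\le c}F(k,\xi)-\sum_{k=1}^{T}F(k,d)}{\frac{1}{p^+}(cK)^{p^+}-\frac{d^{p^-}}{p^-}A}.$$ $]a,b[$ denotes an open interval, and $1/0$ is read as $+\infty$. *)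

theory Defs
  imports "HOL-Analysis.Analysis"
begin

text \<open>
  A function with discrete domain \<open>[a,b]\<close> is a function on \<open>nat\<close>, of which only the values
  on \<open>{a..b}\<close> are used.
  All real exponents below are at least 2 on a non-negative base, or the base is positive,
  or (\<open>p k - 2\<close>, possibly 0) the power is multiplied by its own base; so the convention
  \<open>0 powr 0 = 0\<close> does no harm.
\<close>

definition fdiff :: "(nat \<Rightarrow> real) \<Rightarrow> nat \<Rightarrow> real"  (\<open>\<Delta>\<close>)
  where "\<Delta> u k = u (k + 1) - u k"

definition W_space :: "nat \<Rightarrow> (nat \<Rightarrow> real) set"
  where "W_space T = {u \<in> {0..T+1} \<rightarrow>\<^sub>E UNIV. u 0 = 0 \<and> u (T + 1) = 0}"

definition w_plus :: "nat \<Rightarrow> (nat \<Rightarrow> real) \<Rightarrow> real"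
  where "w_plus T w = Max (w ` {0..T})"

definition p_minus :: "nat \<Rightarrow> (nat \<Rightarrow> real) \<Rightarrow> real"
  where "p_minus T p = Min (p ` {0..T+1})"

definition p_plus :: "nat \<Rightarrow> (nat \<Rightarrow> real) \<Rightarrow> real"
  where "p_plus T p = Max (p ` {0..T+1})"

definition q_plus :: "nat \<Rightarrow> (nat \<Rightarrow> real) \<Rightarrow> real"
  where "q_plus T q = Max (q ` {1..T+1})"

definition alpha_plus :: "nat \<Rightarrow> (nat \<Rightarrow> real) \<Rightarrow> real"
  where "alpha_plus T \<alpha> = Max (\<alpha> ` {1..T})"

text \<open>The interval integral is oriented: for \<open>t < 0\<close> it is minus the integral over \<open>[t,0]\<close>.\<close>

definition primitive :: "(nat \<Rightarrow> real \<Rightarrow> real) \<Rightarrow> nat \<Rightarrow> real \<Rightarrow> real"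
  where "primitive f k t = (LBINT \<xi>=ereal 0..ereal t. f k \<xi>)"

definition A_const :: "nat \<Rightarrow> (nat \<Rightarrow> real) \<Rightarrow> (nat \<Rightarrow> real) \<Rightarrow> real"
  where "A_const T w q = w 0 + w T + (\<Sum>k=1..T. q k)"

definition K_const :: "nat \<Rightarrow> (nat \<Rightarrow> real) \<Rightarrow> (nat \<Rightarrow> real) \<Rightarrow> (nat \<Rightarrow> real) \<Rightarrow> real"
  where "K_const T w p q =
    (2 * real T + 2) powr ((1 - p_plus T p) / p_plus T p) *
    (max (w_plus T w) (q_plus T q)) powr
      ((p_minus T p - p_plus T p) / (p_plus T p * p_minus T p))"

text \<open>
  For continuous \<open>f k\<close> and \<open>c \<ge> 0\<close> the supremum is a maximum, of a continuous function
  on a compact interval.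
  The quotient is meaningful only if its denominator is nonzero (otherwise it is 0 by the
  convention \<open>x / 0 = 0\<close>). A reciprocal with the convention \<open>1 / 0 = \<infinity>\<close> is
  \<open>1 / ereal (a_quot T w p q f d c)\<close>.
\<close>

definition a_quot :: "nat \<Rightarrow> (nat \<Rightarrow> real) \<Rightarrow> (nat \<Rightarrow> real) \<Rightarrow> (nat \<Rightarrow> real) \<Rightarrow>
    (nat \<Rightarrow> real \<Rightarrow> real) \<Rightarrow> real \<Rightarrow> real \<Rightarrow> real"
  where "a_quot T w p q f d c =
    ((\<Sum>k=1..T. SUP \<xi>\<in>{\<xi>. \<bar>\<xi>\<bar> \<le> c}. primitive f k \<xi>) - (\<Sum>k=1..T. primitive f k d)) /
    (1 / p_plus T p * (c * K_const T w p q) powr p_plus T p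
      - d powr p_minus T p / p_minus T p * A_const T w q)"

definition is_solution :: "nat \<Rightarrow> (nat \<Rightarrow> real) \<Rightarrow> (nat \<Rightarrow> real) \<Rightarrow> (nat \<Rightarrow> real) \<Rightarrow>
    (nat \<Rightarrow> real \<Rightarrow> real) \<Rightarrow> real \<Rightarrow> (nat \<Rightarrow> real) \<Rightarrow> bool"
  where "is_solution T w p q f l u \<longleftrightarrow>
    u \<in> W_space T \<and>
    (\<forall>k\<in>{1..T}.
      - \<Delta> (\<lambda>j. w j * \<bar>\<Delta> u j\<bar> powr (p j - 2) * \<Delta> u j) (k - 1)
        + q k * \<bar>u k\<bar> powr (p k - 2) * u k = l * f k (u k))"

end

theory Submission
  imports Defs
begin

text \<open>
  Solutions are the critical points on \<open>W\<close> of \<open>\<Phi> - l \<Psi>\<close>, with \<open>\<Phi>\<close> the energy and \<open>\<Psi>\<close> the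
  potential below. Put \<open>r c = (c K)\<^sup>p / p\<close> with \<open>p = p\<^sup>+\<close>. By the choice of \<open>K\<close>, a function of
  energy at most \<open>r c\<close> with \<open>c K \<le> 1\<close> is bounded by \<open>c\<close>, so \<open>\<Psi>\<close> is at most the sum of the
  maxima of \<open>F\<close> over \<open>[-c, c]\<close>. The function \<open>v\<close> equal to \<open>d\<close> on \<open>[1, T]\<close> has energy strictly
  between \<open>r c1\<close> and \<open>r c2\<close>, and the condition on \<open>l\<close> gives that \<open>\<Phi> - l \<Psi>\<close> is larger on
  the two level sets \<open>\<Phi> = r c1\<close> and \<open>\<Phi> = r c2\<close> than at \<open>v\<close>. Hence its minimum over the compact
  set \<open>r c1 \<le> \<Phi> \<le> r c2\<close> is attained in the interior, which gives a critical point of positive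
  energy.
\<close>

section \<open>Powers of absolute values: derivative and power mean inequality\<close>

lemma has_real_derivative_abs_powr:
  fixes x r :: real
  assumes "r \<ge> 2"
  shows "((\<lambda>x. \<bar>x\<bar> powr r) has_real_derivative r * (\<bar>x\<bar> powr (r - 2) * x)) (at x)"
proof (cases "x = 0")
  case True
  \<comment> \<open>At the origin the difference quotient has absolute value
    \<open>\<bar>h\<bar> powr (r - 1)\<close>, which tends to 0 since
    \<open>r - 1 > 0\<close>.\<close>
  have "((\<lambda>h::real. \<bar>h\<bar> powr (r - 1)) \<longlongrightarrow> 0 powr (r - 1)) (at 0)"
    by (intro tendsto_powr' tendsto_rabs_zero tendsto_ident_at tendsto_const) (use assms in auto)
  moreover have "\<forall>\<^sub>F h in at 0. \<bar>h\<bar> powr (r - 1) = \<bar>\<bar>h\<bar> powr r / (h::real)\<bar>"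
    by (auto simp: eventually_at_filter powr_diff abs_divide)
  ultimately have "((\<lambda>h::real. \<bar>\<bar>h\<bar> powr r / h\<bar>) \<longlongrightarrow> 0) (at 0)"
    using assms by (auto intro: Lim_transform_eventually)
  then have "((\<lambda>h::real. \<bar>h\<bar> powr r / h) \<longlongrightarrow> 0) (at 0)"
    by (rule tendsto_rabs_zero_cancel)
  with True assms show ?thesis
    by (simp add: DERIV_def)
next
  case False
  have "\<bar>x\<bar> powr (r - 1) = \<bar>x\<bar> powr (r - 2) * \<bar>x\<bar>"
    using False powr_mult_base[of "\<bar>x\<bar>" "r - 2"] by (simp add: mult.commute)
  moreover have "((\<lambda>x. \<bar>x\<bar>) has_real_derivative sgn x) (at x)"
  proof -
    have "(\<lambda>h. h * sgn x) = (*) (sgn x)" by (simp add: fun_eq_iff)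
    then show ?thesis
      using has_derivative_norm[OF False]
      by (simp add: has_field_derivative_def real_norm_def[abs_def])
  qed
  moreover have "((\<lambda>z. z powr r) has_real_derivative r * \<bar>x\<bar> powr (r - 1)) (at \<bar>x\<bar>)"
    using False by (intro has_real_derivative_powr) auto
  ultimately show ?thesis
    using DERIV_chain2[of "\<lambda>z. z powr r" "r * \<bar>x\<bar> powr (r - 1)" "\<lambda>x. \<bar>x\<bar>" x "sgn x" UNIV]
    by (simp add: mult.assoc abs_mult_sgn)
qed

text \<open>Power mean inequality. The terms are rescaled by \<open>n / S\<close> to have mean 1,
  and Young's inequality with second factor 1 is applied to each. Summing gives
  \<open>n \<le> (\<Sum>i\<in>I. (n * x i / S) powr r)\<close>, which is the claim after clearing
  denominators.\<close>

lemma sum_powr_le_card_powr: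
  fixes x :: "'a \<Rightarrow> real"
  assumes "finite I" "r > 1" "\<And>i. i \<in> I \<Longrightarrow> 0 \<le> x i"
  shows "(\<Sum>i\<in>I. x i) powr r \<le> real (card I) powr (r - 1) * (\<Sum>i\<in>I. x i powr r)"
proof (cases "(\<Sum>i\<in>I. x i) = 0")
  case True
  then show ?thesis by (simp add: sum_nonneg)
next
  case False
  define S where "S = (\<Sum>i\<in>I. x i)"
  define n where "n = real (card I)"
  have S: "S > 0" using False assms(3) sum_nonneg[of I x] by (simp add: S_def)
  then have "I \<noteq> {}" by (auto simp: S_def)
  then have n: "n > 0" using assms(1) by (simp add: n_def card_gt_0_iff)
  have "n = (\<Sum>i\<in>I. n * x i / S)"
    using S by (simp add: S_def sum_divide_distrib[symmetric] sum_distrib_left[symmetric])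
  also have "\<dots> \<le> (\<Sum>i\<in>I. (n * x i / S) powr r / r + (1 - 1 / r))"
  proof (rule sum_mono)
    fix i assume "i \<in> I"
    moreover have "1 / r + 1 / (r / (r - 1)) = 1" using assms(2) by (simp add: field_simps)
    ultimately show "n * x i / S \<le> (n * x i / S) powr r / r + (1 - 1 / r)"
      using Youngs_inequality[of r "r / (r - 1)" "n * x i / S" 1] assms n S
      by (simp add: diff_divide_distrib)
  qed
  also have "\<dots> = (\<Sum>i\<in>I. (n * x i / S) powr r) / r + n * (1 - 1 / r)"
    by (simp add: sum.distrib sum_divide_distrib[symmetric] n_def)
  finally have "n \<le> (\<Sum>i\<in>I. (n * x i / S) powr r)"
    using assms(2) by (simp add: field_simps)
  also have "\<dots> = (\<Sum>i\<in>I. n powr r * x i powr r / S powr r)"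
    by (intro sum.cong refl) (use n S assms(3) in \<open>simp add: powr_divide powr_mult\<close>)
  also have "\<dots> = n powr r / S powr r * (\<Sum>i\<in>I. x i powr r)"
    by (simp add: sum_distrib_left)
  finally have "n * S powr r \<le> n powr r * (\<Sum>i\<in>I. x i powr r)"
    using S by (simp add: field_simps)
  moreover have "n powr r = n * n powr (r - 1)"
    using n powr_add[of n 1 "r - 1"] by simp
  ultimately show ?thesis
    using n unfolding S_def[symmetric] n_def[symmetric] by (simp add: mult.assoc)
qed

section \<open>The primitive of the nonlinearity\<close>

lemma primitive_has_real_derivative:
  assumes "continuous_on UNIV (f k)"
  shows "(primitive f k has_real_derivative f k t) (at t)"
proof -
  \<comment> \<open>The fundamental theorem gives a derivative within a compact interval; this
    choice puts \<open>t\<close> in its interior, so the derivative is two-sided.\<close>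
  define b where "b = \<bar>t\<bar> + 1"
  have "((\<lambda>u. LBINT y=ereal 0..ereal u. f k y) has_vector_derivative f k t) (at t within {-b..b})"
    by (rule interval_integral_FTC2)
      (auto simp: b_def intro: continuous_on_subset[OF assms])
  moreover have "at t within {-b..b} = at t"
    by (rule at_within_interior) (auto simp: b_def)
  ultimately show ?thesis
    by (simp add: primitive_def[abs_def] has_real_derivative_iff_has_vector_derivative)
qed

lemma primitive_le_SUP:
  assumes "continuous_on UNIV (f k)" "\<bar>x\<bar> \<le> c"
  shows "primitive f k x \<le> (SUP \<xi>\<in>{\<xi>. \<bar>\<xi>\<bar> \<le> c}. primitive f k \<xi>)"
proof (rule cSUP_upper)
  have "continuous_on {-c..c} (primitive f k)"
    using primitive_has_real_derivative[of f k, OF assms(1)]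
    by (auto intro!: continuous_at_imp_continuous_on DERIV_isCont)
  then have "compact (primitive f k ` {-c..c})"
    by (intro compact_continuous_image) auto
  moreover have "{\<xi>. \<bar>\<xi>\<bar> \<le> c} = {-c..c}" by auto
  ultimately show "bdd_above (primitive f k ` {\<xi>. \<bar>\<xi>\<bar> \<le> c})"
    by (simp add: bounded_imp_bdd_above compact_imp_bounded)
qed (use assms in auto)

section \<open>Energy and potential, and their partial derivatives\<close>

definition energy :: "nat \<Rightarrow> (nat \<Rightarrow> real) \<Rightarrow> (nat \<Rightarrow> real) \<Rightarrow> (nat \<Rightarrow> real) \<Rightarrow> (nat \<Rightarrow> real) \<Rightarrow> real"
  where "energy T w p q u =
    (\<Sum>j=0..T. w j / p j * \<bar>\<Delta> u j\<bar> powr p j) + (\<Sum>k=1..T. q k / p k * \<bar>u k\<bar> powr p k)"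

definition potential :: "nat \<Rightarrow> (nat \<Rightarrow> real \<Rightarrow> real) \<Rightarrow> (nat \<Rightarrow> real) \<Rightarrow> real"
  where "potential T f u = (\<Sum>k=1..T. primitive f k (u k))"

text \<open>This links minimisation to the difference equation. The coordinate \<open>u k\<close>
  enters only the differences with index \<open>k - 1\<close> and \<open>k\<close>, with opposite
  signs, so the derivative of the difference part is itself a difference, the outer one of the
  equation.\<close>

lemma energy_has_partial_derivative:
  assumes p: "\<forall>k\<in>{0..T}. p k \<ge> 2" and k: "k \<in> {1..T}"
  shows "((\<lambda>x. energy T w p q (u(k := x))) has_real_derivative
    - \<Delta> (\<lambda>j. w j * \<bar>\<Delta> u j\<bar> powr (p j - 2) * \<Delta> u j) (k - 1)
      + q k * \<bar>u k\<bar> powr (p k - 2) * u k) (at (u k))"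
proof -
  define g where "g j = w j * \<bar>\<Delta> u j\<bar> powr (p j - 2) * \<Delta> u j" for j
  \<comment> \<open>The derivative of \<open>\<Delta> u j\<close> with respect to
    \<open>u k\<close>. Since \<open>k \<ge> 1\<close>, the subtraction \<open>k - 1\<close> is not
    truncated and the two indices differ.\<close>
  define e :: "nat \<Rightarrow> real" where "e j = (if j = k - 1 then 1 else 0) - (if j = k then 1 else 0)" for j
  have lin: "((\<lambda>x. \<Delta> (u(k := x)) j) has_real_derivative e j) (at (u k))" for j
  proof -
    consider "k = Suc j" | "k = j" | "k \<noteq> Suc j" "k \<noteq> j" by blast
    then show ?thesis
      using k by cases (auto simp: fdiff_def e_def intro!: derivative_eq_intros)
  qed
  have diff: "((\<lambda>x. w j / p j * \<bar>\<Delta> (u(k := x)) j\<bar> powr p j) has_real_derivative g j * e j) (at (u k))"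
    if "j \<in> {0..T}" for j
  proof -
    have "p j \<ge> 2" using p that by auto
    from DERIV_cmult[OF DERIV_chain2[OF has_real_derivative_abs_powr[OF this] lin, of j], of "w j / p j"]
    show ?thesis using \<open>p j \<ge> 2\<close> by (simp add: g_def mult_ac)
  qed
  have diag: "((\<lambda>x. q j / p j * \<bar>(u(k := x)) j\<bar> powr p j) has_real_derivative
      (if j = k then q k * \<bar>u k\<bar> powr (p k - 2) * u k else 0)) (at (u k))"
    if "j \<in> {1..T}" for j
  proof (cases "j = k")
    case True
    have "p k \<ge> 2" using p k by auto
    from DERIV_cmult[OF has_real_derivative_abs_powr[OF this, of "u k"], of "q k / p k"] True
    show ?thesis using \<open>p k \<ge> 2\<close> by (simp add: mult_ac)
  qed simp
  have "(\<Sum>j=0..T. g j * e j) = g (k - 1) - g k"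
  proof -
    have "g j * e j = (if j = k - 1 then g j else 0) - (if j = k then g j else 0)" for j
      by (simp add: e_def)
    then show ?thesis
      using k by (auto simp: sum_subtractf sum.delta)
  qed
  also have "\<dots> = - \<Delta> g (k - 1)"
    using k by (simp add: fdiff_def)
  finally have g: "(\<Sum>j=0..T. g j * e j) = - \<Delta> g (k - 1)" .
  have "((\<lambda>x. energy T w p q (u(k := x))) has_real_derivative
      (\<Sum>j=0..T. g j * e j) + (\<Sum>j=1..T. if j = k then q k * \<bar>u k\<bar> powr (p k - 2) * u k else 0)) (at (u k))"
    unfolding energy_def by (intro DERIV_add DERIV_sum diff diag)
  then show ?thesis
    using k unfolding g by (simp add: sum.delta g_def[abs_def])
qed

lemma potential_has_partial_derivative:
  assumes "\<And>k. k \<in> {1..T} \<Longrightarrow> continuous_on UNIV (f k)" "k \<in> {1..T}"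
  shows "((\<lambda>x. potential T f (u(k := x))) has_real_derivative f k (u k)) (at (u k))"
proof -
  have "((\<lambda>x. primitive f j ((u(k := x)) j)) has_real_derivative (if j = k then f k (u k) else 0)) (at (u k))"
    if "j \<in> {1..T}" for j
    using primitive_has_real_derivative[of f j, OF assms(1)[OF that], of "u k"] by auto
  then have "((\<lambda>x. potential T f (u(k := x))) has_real_derivative
      (\<Sum>j=1..T. if j = k then f k (u k) else 0)) (at (u k))"
    unfolding potential_def by (intro DERIV_sum)
  then show ?thesis using assms(2) by (simp add: sum.delta)
qed

section \<open>Continuity of the functionals and compactness in \<open>W_space\<close>\<close>

lemma continuous_on_energy:
  assumes "\<forall>k\<in>{0..T}. p k > 0"
  shows "continuous_on S (energy T w p q)"
  unfolding energy_def[abs_def] fdiff_def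
  by (intro continuous_intros continuous_on_powr'
      continuous_on_subset[OF continuous_on_product_coordinates]) (use assms in auto)

lemma continuous_on_potential:
  assumes "\<And>k. k \<in> {1..T} \<Longrightarrow> continuous_on UNIV (f k)"
  shows "continuous_on S (potential T f)"
proof -
  have "continuous_on UNIV (primitive f k)" if "k \<in> {1..T}" for k
    using primitive_has_real_derivative[of f k, OF assms[OF that]]
    by (auto intro!: continuous_at_imp_continuous_on DERIV_isCont)
  then have "continuous_on S (\<lambda>u. primitive f k (u k))" if "k \<in> {1..T}" for k
    by (rule continuous_on_compose2)
      (use that in \<open>auto intro: continuous_on_subset[OF continuous_on_product_coordinates]\<close>)
  then show ?thesis
    unfolding potential_def[abs_def] by (intro continuous_on_sum)
qed

text \<open>Members of \<open>W_space\<close> are \<open>undefined\<close> beyond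
  \<open>T + 1\<close>, so the set is a product over all of \<open>nat\<close> whose factors are
  compact intervals or singletons. Tychonoff's theorem applies.\<close>

lemma compact_W_space_bounded:
  "compact {u \<in> W_space T. \<forall>k\<in>{1..T}. \<bar>u k\<bar> \<le> c}"
proof -
  define B :: "nat \<Rightarrow> real set" where
    "B i = (if i \<in> {1..T} then {-c..c} else if i \<le> T + 1 then {0} else {undefined})" for i
  have "compactin (product_topology (\<lambda>_. euclidean) UNIV) (PiE UNIV B)"
    by (auto simp: compactin_PiE B_def)
  then have "compact (PiE UNIV B)"
    by (simp add: euclidean_product_topology)
  moreover have "{u \<in> W_space T. \<forall>k\<in>{1..T}. \<bar>u k\<bar> \<le> c} = PiE UNIV B"
  proof (intro set_eqI iffI)
    fix u assume u: "u \<in> {u \<in> W_space T. \<forall>k\<in>{1..T}. \<bar>u k\<bar> \<le> c}"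
    have "u i \<in> B i" for i
    proof -
      consider "i \<in> {1..T}" | "i = 0" | "i = T + 1" | "i > T + 1"
        by fastforce
      then show ?thesis
        using u by cases (auto simp: B_def W_space_def PiE_def extensional_def abs_le_iff minus_le_iff)
    qed
    then show "u \<in> PiE UNIV B" by auto
  next
    fix u assume "u \<in> PiE UNIV B"
    then have u: "u i \<in> B i" for i by auto
    have "u 0 = 0" "u (T + 1) = 0" using u[of 0] u[of "T + 1"] by (auto simp: B_def)
    moreover have "u i = undefined" if "i > T + 1" for i
      using u[of i] that by (auto simp: B_def)
    moreover have "\<bar>u i\<bar> \<le> c" if "i \<in> {1..T}" for i
      using u[of i] that by (auto simp: B_def)
    ultimately show "u \<in> {u \<in> W_space T. \<forall>k\<in>{1..T}. \<bar>u k\<bar> \<le> c}"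
      by (auto simp: W_space_def PiE_def extensional_def)
  qed
  ultimately show ?thesis by simp
qed

section \<open>Pointwise bounds from the energy\<close>

lemma powr_sum_abs_fdiff_le:
  assumes "r > 1"
  shows "(\<Sum>j=0..T. \<bar>\<Delta> u j\<bar>) powr r \<le> (real T + 1) powr (r - 1) * (\<Sum>j=0..T. \<bar>\<Delta> u j\<bar> powr r)"
  using sum_powr_le_card_powr[of "{0..T}" r "\<lambda>j. \<bar>\<Delta> u j\<bar>"] assms by (simp add: add.commute)

lemma abs_le_sum_abs_fdiff:
  assumes "u 0 = 0" "k \<le> T"
  shows "\<bar>u k\<bar> \<le> (\<Sum>j=0..T. \<bar>\<Delta> u j\<bar>)"
proof -
  have "u k = (\<Sum>j<k. \<Delta> u j)"
    using assms(1) by (simp add: fdiff_def sum_lessThan_telescope)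
  then have "\<bar>u k\<bar> \<le> (\<Sum>j<k. \<bar>\<Delta> u j\<bar>)"
    by simp
  also have "\<dots> \<le> (\<Sum>j=0..T. \<bar>\<Delta> u j\<bar>)"
    by (rule sum_mono2) (use assms(2) in auto)
  finally show ?thesis .
qed

lemma p_minus_le: "k \<in> {0..T+1} \<Longrightarrow> p_minus T p \<le> p k"
  by (auto simp: p_minus_def)

lemma le_p_plus: "k \<in> {0..T+1} \<Longrightarrow> p k \<le> p_plus T p"
  by (auto simp: p_plus_def)

lemma le_p_minus: "(\<And>k. k \<in> {0..T+1} \<Longrightarrow> c \<le> p k) \<Longrightarrow> c \<le> p_minus T p"
  by (auto simp: p_minus_def)

text \<open>The base \<open>M\<close> of the second factor of \<open>K\<close> is at least 1 and its
  exponent is at most 0, so that factor is at most 1; the first factor alone gives the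
  bound.\<close>

lemma K_const_pos_le:
  assumes w: "\<forall>k\<in>{0..T}. w k \<ge> 1" and p: "\<forall>k\<in>{0..T+1}. p k \<ge> 2"
  shows "0 < K_const T w p q"
    and "K_const T w p q powr p_plus T p \<le> (2 * real T + 2) powr (1 - p_plus T p)"
proof -
  define pp where "pp = p_plus T p"
  define pm where "pm = p_minus T p"
  define M where "M = max (w_plus T w) (q_plus T q)"
  have pm: "pm \<ge> 2" using p le_p_minus[of T 2 p] by (auto simp: pm_def)
  have pp: "pp \<ge> pm" using p_minus_le[of 0 T p] le_p_plus[of 0 T p] by (simp add: pm_def pp_def)
  have "w 0 \<le> w_plus T w" by (simp add: w_plus_def)
  moreover have "w 0 \<ge> 1" using w by simp
  ultimately have M: "M \<ge> 1" by (simp add: M_def)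
  have K: "K_const T w p q = (2 * real T + 2) powr ((1 - pp) / pp) * M powr ((pm - pp) / (pp * pm))"
    by (simp add: K_const_def M_def pp_def pm_def)
  show "0 < K_const T w p q"
    unfolding K using M by simp
  have "(pm - pp) / (pp * pm) \<le> 0"
    using pm pp by (simp add: divide_nonpos_pos)
  then have "M powr ((pm - pp) / (pp * pm)) \<le> 1"
    using M powr_mono[of "(pm - pp) / (pp * pm)" 0 M] by simp
  then have "K_const T w p q \<le> (2 * real T + 2) powr ((1 - pp) / pp)"
    unfolding K by (simp add: mult_left_le)
  then have "K_const T w p q powr pp \<le> ((2 * real T + 2) powr ((1 - pp) / pp)) powr pp"
    using \<open>0 < K_const T w p q\<close> pm pp by (intro powr_mono2) auto
  then show "K_const T w p q powr p_plus T p \<le> (2 * real T + 2) powr (1 - p_plus T p)"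
    using pm pp by (simp add: powr_powr pp_def)
qed

text \<open>The smallness \<open>c * K \<le> 1\<close> keeps all differences within
  \<open>[-1, 1]\<close>, where the variable exponents may be replaced by the largest one. The power
  mean inequality and telescoping from \<open>u 0 = 0\<close> then bound \<open>u k\<close>, and
  \<open>K\<close> absorbs the factor coming from the number of terms.\<close>

lemma energy_le_imp_abs_le:
  assumes w: "\<forall>k\<in>{0..T}. w k \<ge> 1" and p: "\<forall>k\<in>{0..T+1}. p k \<ge> 2"
    and q: "\<forall>k\<in>{1..T}. q k \<ge> 0"
    and "u 0 = 0" "k \<le> T" "0 \<le> c" "c * K_const T w p q \<le> 1"
    and le: "energy T w p q u \<le> 1 / p_plus T p * (c * K_const T w p q) powr p_plus T p"
  shows "\<bar>u k\<bar> \<le> c"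
proof -
  define pp where "pp = p_plus T p"
  define K where "K = K_const T w p q"
  note K = K_const_pos_le[OF w p, of q, folded K_def pp_def]
  have pp: "pp \<ge> 2" using p le_p_plus[of 0 T p] by (force simp: pp_def)
  have p_pos: "p j > 0" if "j \<in> {0..T+1}" for j using p that by force
  have w_nonneg: "w j \<ge> 0" if "j \<in> {0..T}" for j using bspec[OF w that] by simp
  define g where "g j = w j / p j * \<bar>\<Delta> u j\<bar> powr p j" for j
  have le_g: "\<bar>\<Delta> u j\<bar> powr p j / pp \<le> g j" if "j \<in> {0..T}" for j
  proof -
    have "1 / pp \<le> w j / p j"
      using w w_nonneg that le_p_plus[of j T p] p_pos[of j] by (intro frac_le) (auto simp: pp_def)
    then show ?thesis
      unfolding g_def by (metis mult_right_mono powr_ge_zero mult_1 times_divide_eq_left)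
  qed
  have g_nonneg: "g j \<ge> 0" if "j \<in> {0..T}" for j
    using w_nonneg p_pos[of j] that by (simp add: g_def)
  have "(\<Sum>k=1..T. q k / p k * \<bar>u k\<bar> powr p k) \<ge> 0"
    using q p_pos by (intro sum_nonneg mult_nonneg_nonneg divide_nonneg_pos) auto
  then have sum_g: "(\<Sum>j=0..T. g j) \<le> (c * K) powr pp / pp"
    using le by (simp add: energy_def g_def K_def pp_def)
  \<comment> \<open>A difference larger than 1 would alone contribute more than
    \<open>1 / pp\<close>, while the whole sum is at most
    \<open>(c * K) powr pp / pp \<le> 1 / pp\<close>.\<close>
  have small: "\<bar>\<Delta> u j\<bar> \<le> 1" if "j \<in> {0..T}" for j
  proof (rule ccontr)
    assume "\<not> \<bar>\<Delta> u j\<bar> \<le> 1"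
    then have "1 < \<bar>\<Delta> u j\<bar> powr p j"
      using powr_less_mono2[of "p j" 1 "\<bar>\<Delta> u j\<bar>"] p_pos[of j] that by simp
    moreover have "g j \<le> (\<Sum>j=0..T. g j)"
      using that g_nonneg by (intro member_le_sum) auto
    moreover have "(c * K) powr pp \<le> 1"
      using assms(6,7) K pp powr_mono2[of pp "c * K" 1] by (simp add: K_def)
    moreover have "\<bar>\<Delta> u j\<bar> powr p j / pp \<le> (c * K) powr pp / pp"
      using le_g[OF that] sum_g \<open>g j \<le> _\<close> by linarith
    ultimately show False
      using pp by (simp add: divide_le_cancel)
  qed
  have "(\<Sum>j=0..T. \<bar>\<Delta> u j\<bar> powr pp) / pp \<le> (\<Sum>j=0..T. g j)"
    unfolding sum_divide_distrib
  proof (rule sum_mono)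
    fix j assume j: "j \<in> {0..T}"
    have "\<bar>\<Delta> u j\<bar> powr pp \<le> \<bar>\<Delta> u j\<bar> powr p j"
      using small[OF j] le_p_plus[of j T p] j by (intro powr_mono') (auto simp: pp_def)
    then show "\<bar>\<Delta> u j\<bar> powr pp / pp \<le> g j"
      using le_g[OF j] pp by (smt (verit) divide_right_mono)
  qed
  with sum_g pp have sum_pp: "(\<Sum>j=0..T. \<bar>\<Delta> u j\<bar> powr pp) \<le> (c * K) powr pp"
    by (smt (verit) divide_le_cancel)
  have "(\<Sum>j=0..T. \<bar>\<Delta> u j\<bar>) powr pp \<le> (real T + 1) powr (pp - 1) * (c * K) powr pp"
    by (rule order_trans[OF powr_sum_abs_fdiff_le mult_left_mono[OF sum_pp]]) (use pp in auto)
  also have "\<dots> = c powr pp * ((real T + 1) powr (pp - 1) * K powr pp)"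
    using K(1) assms(6) by (simp add: powr_mult)
  \<comment> \<open>Enlarging \<open>real T + 1\<close> to \<open>2 * real T + 2\<close> makes the
    power cancel exactly against the bound for \<open>K powr pp\<close>.\<close>
  also have "\<dots> \<le> c powr pp * ((2 * real T + 2) powr (pp - 1) * (2 * real T + 2) powr (1 - pp))"
    using K pp by (intro mult_left_mono mult_mono powr_mono2) auto
  also have "\<dots> = c powr pp"
    by (simp add: powr_add[symmetric])
  finally have "(\<Sum>j=0..T. \<bar>\<Delta> u j\<bar>) \<le> c"
    using powr_less_mono2[of pp c "\<Sum>j=0..T. \<bar>\<Delta> u j\<bar>"] pp assms(6) by force
  then show ?thesis
    using abs_le_sum_abs_fdiff[of u k T] assms(4,5) by simp
qed

section \<open>Energy of the plateau function\<close>

lemma energy_plateau_bounds: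
  assumes "T \<ge> 2" and w: "\<forall>k\<in>{0..T}. w k \<ge> 1" and p: "\<forall>k\<in>{0..T+1}. p k \<ge> 2"
    and q: "\<forall>k\<in>{0..T+1}. q k \<ge> 1"
    and d: "0 < d" "d \<le> 1"
    and v: "v = (\<lambda>k\<in>{0..T+1}. if k \<in> {1..T} then d else 0)"
  shows "A_const T w q * d powr p_plus T p / p_plus T p \<le> energy T w p q v"
    and "energy T w p q v \<le> A_const T w q * d powr p_minus T p / p_minus T p"
proof -
  define pp where "pp = p_plus T p"
  define pm where "pm = p_minus T p"
  have p_pos: "p j > 0" if "j \<in> {0..T+1}" for j using p that by force
  have pm: "pm \<ge> 2" using p le_p_minus[of T 2 p] by (auto simp: pm_def)
  \<comment> \<open>The plateau jumps only at \<open>0\<close> and \<open>T\<close>, by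
    \<open>d\<close> and \<open>- d\<close>. In between the difference is 0 and its power vanishes,
    so these weights together with \<open>q\<close> add up to \<open>A_const T w q\<close>.\<close>
  define h where "h j = (if j = 0 then w 0 else 0) + (if j = T then w T else 0)" for j
  have h: "w j / p j * \<bar>\<Delta> v j\<bar> powr p j = h j / p j * d powr p j" if "j \<in> {0..T}" for j
  proof -
    from that consider "j = 0" | "j = T" | "0 < j" "j < T"
      by (metis atLeastAtMost_iff le_neq_implies_less neq0_conv)
    then show ?thesis
      using assms(1) d(1) by cases (auto simp: h_def v fdiff_def)
  qed
  have sum_h: "(\<Sum>j=0..T. h j) = w 0 + w T"
    by (simp add: h_def sum.distrib sum.delta)
  have h_nonneg: "h j \<ge> 0" if "j \<in> {0..T}" for j
  proof -
    have "w 0 \<ge> 1" "w T \<ge> 1" using w by auto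
    then show ?thesis by (simp add: h_def)
  qed
  have eq: "energy T w p q v = (\<Sum>j=0..T. h j / p j * d powr p j) + (\<Sum>k=1..T. q k / p k * d powr p k)"
    unfolding energy_def using d(1)
    by (intro arg_cong2[where f="(+)"] sum.cong refl h) (auto simp: v)
  \<comment> \<open>For \<open>0 < d \<le> 1\<close> the quantity \<open>d powr s / s\<close>
    decreases in \<open>s > 0\<close>, so the extreme exponents give the two bounds.\<close>
  have lo: "x * (d powr pp / pp) \<le> x / p j * d powr p j" if "x \<ge> 0" "j \<in> {0..T+1}" for x j
  proof -
    have "d powr pp / pp \<le> d powr p j / p j"
      using le_p_plus[OF that(2), of p] p_pos[OF that(2)] d
      by (intro frac_le powr_mono') (auto simp: pp_def)
    from mult_left_mono[OF this that(1)] show ?thesis by simp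
  qed
  have hi: "x / p j * d powr p j \<le> x * (d powr pm / pm)" if "x \<ge> 0" "j \<in> {0..T+1}" for x j
  proof -
    have "d powr p j / p j \<le> d powr pm / pm"
      using p_minus_le[OF that(2), of p] pm d
      by (intro frac_le powr_mono') (auto simp: pm_def)
    from mult_left_mono[OF this that(1)] show ?thesis by simp
  qed
  have A: "A_const T w q * x = (\<Sum>j=0..T. h j * x) + (\<Sum>k=1..T. q k * x)" for x
    by (simp add: A_const_def sum_h sum_distrib_right[symmetric] distrib_right)
  have q_nonneg: "q k \<ge> 0" if "k \<in> {1..T}" for k using bspec[OF q, of k] that by simp
  have "A_const T w q * (d powr pp / pp) \<le> energy T w p q v"
    unfolding A eq by (intro add_mono sum_mono lo h_nonneg q_nonneg) auto
  then show "A_const T w q * d powr p_plus T p / p_plus T p \<le> energy T w p q v"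
    by (simp add: pp_def)
  have "energy T w p q v \<le> A_const T w q * (d powr pm / pm)"
    unfolding A eq by (intro add_mono sum_mono hi h_nonneg q_nonneg) auto
  then show "energy T w p q v \<le> A_const T w q * d powr p_minus T p / p_minus T p"
    by (simp add: pm_def)
qed

section \<open>Minimisation between two energy levels\<close>

lemma critical_point_in_annulus:
  fixes l r1 r2 c :: real
  assumes f: "\<And>k. k \<in> {1..T} \<Longrightarrow> continuous_on UNIV (f k)"
    and p: "\<forall>k\<in>{0..T+1}. p k \<ge> 2"
    and bdd: "\<And>u k. u \<in> W_space T \<Longrightarrow> energy T w p q u \<le> r2 \<Longrightarrow> k \<in> {1..T} \<Longrightarrow> \<bar>u k\<bar> \<le> c"
    and v: "v \<in> W_space T" "r1 \<le> energy T w p q v" "energy T w p q v \<le> r2"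
    and lo: "\<And>u. u \<in> W_space T \<Longrightarrow> energy T w p q u = r1 \<Longrightarrow>
      energy T w p q v - l * potential T f v < energy T w p q u - l * potential T f u"
    and hi: "\<And>u. u \<in> W_space T \<Longrightarrow> energy T w p q u = r2 \<Longrightarrow>
      energy T w p q v - l * potential T f v < energy T w p q u - l * potential T f u"
  shows "\<exists>u. is_solution T w p q f l u \<and> r1 < energy T w p q u"
proof -
  define E where "E = energy T w p q"
  define J where "J u = E u - l * potential T f u" for u
  \<comment> \<open>The pointwise bound is built in to make \<open>C\<close> compact; by
    \<open>bdd\<close> it already follows from the upper energy level, so \<open>C\<close> is the
    full annulus in \<open>W_space T\<close>.\<close>
  define C where "C = {u \<in> W_space T. \<forall>k\<in>{1..T}. \<bar>u k\<bar> \<le> c} \<inter> (E -` {r1..r2})"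
  have p_pos: "\<forall>k\<in>{0..T}. p k > 0"
  proof
    fix k assume "k \<in> {0..T}"
    then show "p k > 0" using bspec[OF p, of k] by simp
  qed
  have contE: "continuous_on UNIV E"
    unfolding E_def using p_pos by (rule continuous_on_energy)
  have "continuous_on C J"
    unfolding J_def[abs_def]
    by (intro continuous_intros continuous_on_subset[OF contE] continuous_on_potential f) auto
  moreover have "compact C"
    unfolding C_def
    by (intro compact_Int_closed compact_W_space_bounded closed_vimage[OF _ contE]) auto
  moreover have C: "u \<in> C \<longleftrightarrow> u \<in> W_space T \<and> E u \<in> {r1..r2}" for u
    using bdd by (auto simp: C_def E_def)
  moreover have vC: "v \<in> C" using v by (simp add: C E_def)
  ultimately obtain u where u: "u \<in> C" and min: "\<And>y. y \<in> C \<Longrightarrow> J u \<le> J y"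
    using continuous_attains_inf[of C J] by blast
  \<comment> \<open>On either boundary level \<open>J\<close> is strictly larger than
    \<open>J v\<close>, so the minimiser lies strictly between the levels.\<close>
  have "J u \<le> J v" using min vC by blast
  then have E: "r1 < E u" "E u < r2"
    using lo[of u] hi[of u] u unfolding C by (force simp: J_def E_def)+
  have "- \<Delta> (\<lambda>j. w j * \<bar>\<Delta> u j\<bar> powr (p j - 2) * \<Delta> u j) (k - 1)
      + q k * \<bar>u k\<bar> powr (p k - 2) * u k - l * f k (u k) = 0" (is "?D = 0")
    if k: "k \<in> {1..T}" for k
  proof -
    have DE: "((\<lambda>x. E (u(k := x))) has_real_derivative
        - \<Delta> (\<lambda>j. w j * \<bar>\<Delta> u j\<bar> powr (p j - 2) * \<Delta> u j) (k - 1)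
        + q k * \<bar>u k\<bar> powr (p k - 2) * u k) (at (u k))"
      unfolding E_def using p k by (intro energy_has_partial_derivative) auto
    have "((\<lambda>x. J (u(k := x))) has_real_derivative ?D) (at (u k))"
      unfolding J_def
      by (intro DERIV_diff DE DERIV_cmult potential_has_partial_derivative f k)
    \<comment> \<open>By continuity a small change of one coordinate stays in the open annulus, so
      \<open>u\<close> is a local minimum in each coordinate and every partial derivative
      vanishes.\<close>
    moreover have "\<forall>\<^sub>F x in nhds (u k). E (u(k := x)) \<in> {r1<..<r2}"
    proof (rule topological_tendstoD)
      have "isCont (\<lambda>x. E (u(k := x))) (u k)" using DE by (rule DERIV_isCont)
      then show "((\<lambda>x. E (u(k := x))) \<longlongrightarrow> E u) (nhds (u k))"
        using tendsto_nhds_iff[of "\<lambda>x. E (u(k := x))" "E u" "u k"]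
        by (simp add: isCont_def)
    qed (use E in auto)
    then obtain e where "e > 0" and e: "\<And>x. dist x (u k) < e \<Longrightarrow> E (u(k := x)) \<in> {r1<..<r2}"
      unfolding eventually_nhds_metric by blast
    moreover have "\<forall>y. \<bar>u k - y\<bar> < e \<longrightarrow> J (u(k := u k)) \<le> J (u(k := y))"
    proof (intro allI impI)
      fix y assume "\<bar>u k - y\<bar> < e"
      then have "E (u(k := y)) \<in> {r1<..<r2}"
        by (intro e) (simp add: dist_real_def abs_minus_commute)
      moreover have "u(k := y) \<in> W_space T"
        using u k unfolding C by (auto simp: W_space_def PiE_def extensional_def)
      ultimately show "J (u(k := u k)) \<le> J (u(k := y))"
        using min[of "u(k := y)"] by (simp add: C)
    qed
    ultimately show ?thesis by (intro DERIV_local_min[of "\<lambda>x. J (u(k := x))"])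
  qed
  then have "is_solution T w p q f l u"
    using u unfolding C is_solution_def by auto
  with E show ?thesis by (auto simp: E_def)
qed

section \<open>Choice of levels and use of the parameter interval\<close>

theorem theorem3p1:
  fixes T :: nat
    and w p q \<alpha> :: "nat \<Rightarrow> real"
    and f :: "nat \<Rightarrow> real \<Rightarrow> real"
    and c0 c1 c2 d l :: real
  defines "A \<equiv> A_const T w q"
    and "K \<equiv> K_const T w p q"
    and "pm \<equiv> p_minus T p"
    and "pp \<equiv> p_plus T p"
    and "a \<equiv> a_quot T w p q f d"
  assumes "T \<ge> 2"
    and "continuous_on ({1..T} \<times> UNIV) (\<lambda>(k, t). f k t)"
    and "\<forall>k\<in>{0..T}. w k \<ge> 1"
    and "\<forall>k\<in>{0..T+1}. p k \<ge> 2"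
    and "\<forall>k\<in>{0..T+1}. q k \<ge> 1"
    and "c0 > 0"
    and "\<forall>k\<in>{1..T}. \<alpha> k \<ge> 2"
    and "alpha_plus T \<alpha> < pm"
    and "\<forall>k\<in>{1..T}. \<forall>t. primitive f k t \<le> c0 * (1 + \<bar>t\<bar> powr \<alpha> k)"
    and "c1 \<ge> 0" and "c2 > 0" and "d > 0"
    and "K / A powr (1 / pp) * c1 < d"
    and "d < (pm * K powr pp / (pp * A)) powr (1 / pm) * c2 powr (pp / pm)"
    and "(pm * K powr pp / (pp * A)) powr (1 / pm) * c2 powr (pp / pm)
           < (pm / (pp * A)) powr (1 / pm)"
    and "a c2 < a c1"
    and "ereal l \<in> {1 / ereal (a c1) <..< 1 / ereal (a c2)}"
  shows "\<exists>u0. is_solution T w p q f l u0 \<and> (\<exists>k\<in>{0..T+1}. u0 k \<noteq> 0)"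
proof -
  note T = \<open>T \<ge> 2\<close> and w = assms(8) and p = assms(9) and q = assms(10)
  have q1: "\<forall>k\<in>{1..T}. q k \<ge> 0"
  proof
    fix k assume "k \<in> {1..T}"
    then show "q k \<ge> 0" using bspec[OF q, of k] by simp
  qed
  have f: "continuous_on UNIV (f k)" if "k \<in> {1..T}" for k
  proof -
    have "continuous_on UNIV (\<lambda>t. (\<lambda>(k, t). f k t) (k, t))"
      by (rule continuous_on_compose2[OF assms(7)]) (use that in \<open>auto intro!: continuous_intros\<close>)
    then show ?thesis by simp
  qed
  \<comment> \<open>These abbreviations make \<open>a c\<close> the quotient of
    \<open>S c - Psi v\<close> by \<open>r c - Dv\<close>; \<open>Dv\<close> is the upper bound for
    the energy of the plateau \<open>v\<close>.\<close>
  define r where "r c = 1 / pp * (c * K) powr pp" for c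
  define Dv where "Dv = d powr pm / pm * A"
  define S where "S c = (\<Sum>k=1..T. SUP \<xi>\<in>{\<xi>. \<bar>\<xi>\<bar> \<le> c}. primitive f k \<xi>)" for c
  define v where "v = (\<lambda>k\<in>{0..T+1}. if k \<in> {1..T} then d else 0)"
  define E where "E = energy T w p q"
  define Psi where "Psi = potential T f"
  have a: "a c = (S c - Psi v) / (r c - Dv)" for c
    by (simp add: a_def a_quot_def S_def Psi_def potential_def v_def r_def Dv_def
        A_def K_def pp_def pm_def)
  have pm: "pm \<ge> 2" using p le_p_minus[of T 2 p] by (auto simp: pm_def)
  have pp: "pp \<ge> pm" using p_minus_le[of 0 T p] le_p_plus[of 0 T p] by (simp add: pm_def pp_def)
  have K: "K > 0" using K_const_pos_le(1)[OF w p] by (simp add: K_def)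
  have A: "A \<ge> 1"
  proof -
    have "w 0 \<ge> 1" "w T \<ge> 1" using w by auto
    moreover have "(\<Sum>k=1..T. q k) \<ge> 0" using q1 by (intro sum_nonneg) auto
    ultimately show ?thesis by (simp add: A_def A_const_def)
  qed
  define X where "X = pm / (pp * A)"
  have X: "0 < X" "X \<le> 1"
    using pm pp A mult_mono[of pm pp 1 A] by (auto simp: X_def)
  \<comment> \<open>Writing the middle term of the chain as one \<open>pm\<close>-th root lets both
    inequalities be raised to the power \<open>pm\<close>.\<close>
  have Y: "(pm * K powr pp / (pp * A)) powr (1 / pm) * c2 powr (pp / pm)
      = (X * (c2 * K) powr pp) powr (1 / pm)"
    using K X pm pp A \<open>c2 > 0\<close> by (simp add: X_def powr_mult powr_divide powr_powr)
  have "d powr pm < X * (c2 * K) powr pp"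
    using powr_less_mono2[OF _ _ assms(19)[unfolded Y], of pm] pm X K \<open>d > 0\<close> \<open>c2 > 0\<close>
    by (simp add: powr_powr)
  moreover have "X * (c2 * K) powr pp < X"
    using powr_less_mono2[OF _ _ assms(20)[unfolded Y], of pm] pm X K \<open>c2 > 0\<close>
    by (simp add: powr_powr X_def[symmetric])
  ultimately have dX: "d powr pm < X * (c2 * K) powr pp" "X * (c2 * K) powr pp < X" .
  have Dv_less: "Dv < r c2"
    using dX(1) pm pp A by (simp add: Dv_def r_def X_def field_simps)
  \<comment> \<open>The two smallness conditions drawn from \<open>dX\<close>: this one is for the
    pointwise bound, \<open>d \<le> 1\<close> is for the energy of the plateau.\<close>
  have c2K: "c2 * K \<le> 1"
  proof (rule ccontr)
    assume "\<not> c2 * K \<le> 1"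
    then have "1 \<le> (c2 * K) powr pp" using pm pp by (intro ge_one_powr_ge_zero) auto
    with dX(2) X show False by simp
  qed
  have d1: "d \<le> 1"
  proof (rule ccontr)
    assume "\<not> d \<le> 1"
    then have "1 \<le> d powr pm" using pm by (intro ge_one_powr_ge_zero) auto
    with dX X show False by linarith
  qed
  have v: "v \<in> W_space T" by (auto simp: v_def W_space_def)
  have Ev: "A * d powr pp / pp \<le> E v" "E v \<le> Dv"
    using energy_plateau_bounds[OF T w p q \<open>d > 0\<close> d1 v_def]
    by (simp_all add: E_def A_def pp_def pm_def Dv_def mult.commute)
  \<comment> \<open>The lower condition on \<open>d\<close>, raised to the power \<open>pp\<close>,
    places \<open>r c1\<close> below the lower bound for the plateau energy.\<close>
  have "c1 * K < d * A powr (1 / pp)"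
    using assms(18) A by (simp add: field_simps)
  then have "(c1 * K) powr pp < (d * A powr (1 / pp)) powr pp"
    using \<open>c1 \<ge> 0\<close> K pm pp by (intro powr_less_mono2) auto
  also have "\<dots> = A * d powr pp"
    using A pm pp \<open>d > 0\<close> by (simp add: powr_mult powr_powr)
  finally have "r c1 < A * d powr pp / pp"
    using pm pp by (simp add: r_def divide_strict_right_mono)
  with Ev Dv_less have r1: "r c1 < E v" and r2: "E v < r c2" by auto
  \<comment> \<open>The order of the constants follows from that of the levels; it lets the
    pointwise bound be used at \<open>c1\<close> as well.\<close>
  have c12: "c1 \<le> c2"
  proof (rule ccontr)
    assume "\<not> c1 \<le> c2"
    then have "(c2 * K) powr pp \<le> (c1 * K) powr pp"
      using K pm pp \<open>c2 > 0\<close> by (intro powr_mono2) auto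
    then have "r c2 \<le> r c1" using pm pp by (simp add: r_def divide_right_mono)
    with r1 r2 show False by simp
  qed
  have bdd: "\<bar>u k\<bar> \<le> c"
    if "u \<in> W_space T" "E u \<le> r c" "0 \<le> c" "c \<le> c2" "k \<in> {1..T}" for u k c
  proof (rule energy_le_imp_abs_le[OF w p q1])
    have "c * K \<le> c2 * K" using that K by (intro mult_right_mono) auto
    then show "c * K_const T w p q \<le> 1" using c2K by (simp add: K_def)
  qed (use that in \<open>auto simp: W_space_def r_def E_def K_def pp_def\<close>)
  have Psi_le: "Psi u \<le> S c"
    if "u \<in> W_space T" "E u \<le> r c" "0 \<le> c" "c \<le> c2" for u c
    unfolding Psi_def potential_def S_def
    by (intro sum_mono primitive_le_SUP f bdd[OF that])
  \<comment> \<open>This settles the signs: \<open>a c2\<close> is a quotient of a nonnegative by a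
    positive number, hence \<open>a c1 > 0\<close> and \<open>l > 0\<close>.\<close>
  have "Psi v \<le> S c2" using Psi_le[of v c2] v r2 \<open>c2 > 0\<close> by simp
  then have a2: "a c2 \<ge> 0" using Dv_less by (simp add: a)
  with assms(21) have a1: "a c1 > 0" by simp
  have ereal_inv: "1 / ereal x = ereal (1 / x)" if "x \<noteq> 0" for x :: real
    using that ereal_divide[of 1 x] by (simp add: one_ereal_def)
  have l1: "l * a c1 > 1"
    using assms(22) a1 by (simp add: ereal_inv field_simps)
  with a1 have l: "l > 0" by (metis less_trans zero_less_mult_pos2 zero_less_one)
  \<comment> \<open>If \<open>a c2 = 0\<close>, the right end of the interval is infinite and the
    product is 0.\<close>
  have l2: "l * a c2 < 1"
    using assms(22) a2 by (cases "a c2 = 0") (auto simp: ereal_inv field_simps)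
  have J1: "r c1 - l * S c1 > E v - l * Psi v"
  proof -
    \<comment> \<open>The denominator of \<open>a c1\<close> is negative, so clearing it turns
      \<open>l * a c1 > 1\<close> into an upper bound for \<open>l * (S c1 - Psi v)\<close>.
      Replacing \<open>Dv\<close> by the smaller \<open>E v\<close> keeps the inequality.\<close>
    have "r c1 - Dv < 0" using r1 Ev by simp
    with l1 have "l * (S c1 - Psi v) < r c1 - Dv" by (simp add: a field_simps)
    with Ev show ?thesis by (simp add: algebra_simps)
  qed
  have J2: "r c2 - l * S c2 > E v - l * Psi v"
  proof -
    have "l * (S c2 - Psi v) < r c2 - Dv" using l2 Dv_less by (simp add: a field_simps)
    with Ev show ?thesis by (simp add: algebra_simps)
  qed
  have "\<exists>u. is_solution T w p q f l u \<and> r c1 < energy T w p q u"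
  proof (rule critical_point_in_annulus[where v = v and ?r2.0 = "r c2" and c = c2])
    fix u assume u: "u \<in> W_space T"
    show "energy T w p q v - l * potential T f v < energy T w p q u - l * potential T f u"
      if "energy T w p q u = r c1"
    proof -
      have "l * Psi u \<le> l * S c1"
        using Psi_le[OF u, of c1] that c12 \<open>c1 \<ge> 0\<close> l by (simp add: E_def)
      with J1 that show ?thesis by (simp add: E_def Psi_def)
    qed
    show "energy T w p q v - l * potential T f v < energy T w p q u - l * potential T f u"
      if "energy T w p q u = r c2"
    proof -
      have "l * Psi u \<le> l * S c2"
        using Psi_le[OF u, of c2] that \<open>c2 > 0\<close> l by (simp add: E_def)
      with J2 that show ?thesis by (simp add: E_def Psi_def)
    qed
  qed (use f p v r1 r2 bdd[of _ c2] \<open>c2 > 0\<close> in \<open>auto simp: E_def\<close>)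
  then obtain u where u: "is_solution T w p q f l u" "r c1 < energy T w p q u" by blast
  \<comment> \<open>The zero function has energy 0, which is not above the nonnegative level
    \<open>r c1\<close>.\<close>
  have "\<exists>k\<in>{0..T+1}. u k \<noteq> 0"
  proof (rule ccontr)
    assume "\<not> (\<exists>k\<in>{0..T+1}. u k \<noteq> 0)"
    then have "energy T w p q u = 0" by (simp add: energy_def fdiff_def)
    moreover have "r c1 \<ge> 0" using pm pp by (simp add: r_def)
    ultimately show False using u(2) by simp
  qed
  with u(1) show ?thesis by blast
qed

end
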